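(* Let $C\subseteq\mathbb{F}_q^n$ be an $[n,k]$ code over $\mathbb{F}_q$, let $C^\perp$ be its dual code, let $T\subseteq[n]$, and let $m$ be a positive integer. Then $$J_{C^{\perp},T}(w,z,x,y;q^m)=q^{-km}\,J_{C,T}\bigl(w+(q^m-1)z,\;w-z,\;x+(q^m-1)y,\;x-y;\;q^m\bigr).$$
   Context: $q$ is a prime power, $[n]=\{1,\dots,n\}$, and $\overline{T}=[n]\setminus T$. An $[n,k]$ code over $\mathbb{F}_q$ is a $k$-dimensional $\mathbb{F}_q$-linear subspace $C$ of $\mathbb{F}_q^n$; its dual is $C^\perp=\{u\in\mathbb{F}_q^n : \sum_i u_iv_i=0\ \text{for all } v\in C\}$. For a positive integer $m$, the $\mathbb{F}_{q^m}$-extension code $C[q^m]=C\otimes\mathbb{F}_{q^m}\subseteq\mathbb{F}_{q^m}^n$ is the set of all $\mathbb{F}_{q^m}$-linear combinations of codewords of $C$. For a vector $u$ and $S\subseteq[n]$, $\mathrm{wt}_S(u)=\#\{i\in S : u_i\ne0\}$. The $q^m$-extended Jacobi polynomial of a linear code $C$ of length $n$ over $\mathbb{F}_q$ associated to $T$ is $$J_{C,T}(w,z,x,y;q^m)=\sum_{i=0}^{n-|T|}\sum_{j=0}^{|T|}A_{i,j}^{q^m}(C;T)\,w^{|T|-j}z^{j}x^{n-|T|-i}y^{i},$$ where $A_{i,j}^{q^m}(C;T)=\#\{u\in C[q^m] : \mathrm{wt}_{\overline{T}}(u)=i,\ \mathrm{wt}_T(u)=j\}$ (a polynomial in indeterminates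 $w,z,x,y$). *)

theory Defs
  imports "HOL-Analysis.Cartesian_Space" "HOL-Library.Poly_Mapping"
begin

(* Codes of length n = CARD('n) over a finite field 'a are the subspaces of 'a ^ 'n;
   the index type 'n plays the role of [n]. *)

definition dual_code :: "('a::field ^ 'n) set \<Rightarrow> ('a ^ 'n) set" where
  "dual_code C = {u. \<forall>v\<in>C. (\<Sum>i\<in>UNIV. u $ i * v $ i) = 0}"

(* The inclusion of F_q into F_{q^m} relates two different types, so it is an explicit
   embedding; injectivity is automatic between fields. *)

definition field_embedding :: "('a::field \<Rightarrow> 'b::field) \<Rightarrow> bool" where
  "field_embedding \<iota> \<longleftrightarrow> \<iota> 1 = 1 \<and> (\<forall>a b. \<iota> (a + b) = \<iota> a + \<iota> b) \<and> (\<forall>a b. \<iota> (a * b) = \<iota> a * \<iota> b)"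

definition ext_code :: "('a::field \<Rightarrow> 'b::field) \<Rightarrow> ('a ^ 'n) set \<Rightarrow> ('b ^ 'n) set" where
  "ext_code \<iota> C = vec.span ((\<lambda>u. \<chi> i. \<iota> (u $ i)) ` C)"

definition wt_on :: "'n set \<Rightarrow> 'b::zero ^ 'n \<Rightarrow> nat" where
  "wt_on S u = card {i \<in> S. u $ i \<noteq> 0}"

definition split_count ::
  "('a::field \<Rightarrow> 'b::field) \<Rightarrow> ('a ^ 'n) set \<Rightarrow> 'n set \<Rightarrow> nat \<Rightarrow> nat \<Rightarrow> nat" where
  "split_count \<iota> C T i j = card {u \<in> ext_code \<iota> C. wt_on (- T) u = i \<and> wt_on T u = j}"

(* Polynomials over the rationals in the four indeterminates w, z, x, y: finitely supported
   functions from exponent vectors to coefficients, with the convolution product. *)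

datatype indet = W | Z | X | Y

type_synonym poly4 = "(indet \<Rightarrow>\<^sub>0 nat) \<Rightarrow>\<^sub>0 rat"

definition Const :: "rat \<Rightarrow> poly4" where
  "Const c = Poly_Mapping.single 0 c"

definition Var :: "indet \<Rightarrow> poly4" where
  "Var v = Poly_Mapping.single (Poly_Mapping.single v 1) 1"

(* psubst p a b c d is p(a, b, c, d), for the order w, z, x, y of the indeterminates. *)

definition psubst :: "poly4 \<Rightarrow> poly4 \<Rightarrow> poly4 \<Rightarrow> poly4 \<Rightarrow> poly4 \<Rightarrow> poly4" where
  "psubst p a b c d =
    (\<Sum>e\<in>Poly_Mapping.keys p. Const (Poly_Mapping.lookup p e) *
      a ^ Poly_Mapping.lookup e W * b ^ Poly_Mapping.lookup e Z *
      c ^ Poly_Mapping.lookup e X * d ^ Poly_Mapping.lookup e Y)"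

definition jacobi :: "('a::field \<Rightarrow> 'b::field) \<Rightarrow> ('a ^ 'n) set \<Rightarrow> 'n set \<Rightarrow> poly4" where
  "jacobi \<iota> C T =
    (\<Sum>i = 0..CARD('n) - card T. \<Sum>j = 0..card T.
      of_nat (split_count \<iota> C T i j) *
      Var W ^ (card T - j) * Var Z ^ j * Var X ^ (CARD('n) - card T - i) * Var Y ^ i)"

end

theory Submission
  imports Defs
begin

text \<open>
  Let \<open>D\<close> be the extension code over the field with \<open>Q = q ^ m\<close> elements. The coefficients of
  a Jacobi polynomial count codewords by their weights on \<open>T\<close> and off \<open>T\<close>, so the polynomial is a
  sum over codewords of products over coordinates: a coordinate contributes one of two values,
  according to whether the codeword vanishes there, and the pair of values depends on whether the
  coordinate is in \<open>T\<close>. The theorem is thus a case of a MacWilliams identity in which each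
  coordinate \<open>i\<close> has its own pair of weights \<open>a i\<close> (zero) and \<open>b i\<close> (nonzero), in any
  commutative ring (\<open>macwilliams_product\<close>).

  That identity is obtained by counting, so that all values stay in the coefficient
  ring. Counting the orthogonal pairs in \<open>D \<times> V\<close> from either
  side gives the symmetric relation \<open>|D| |D\<^sup>\<bottom> \<inter> V| = |V| |D \<inter> V\<^sup>\<bottom>|\<close> for
  subspaces \<open>D\<close> and \<open>V\<close> (\<open>card_dual_Int\<close>). For \<open>V\<close> the space of vectors that vanish on a set
  \<open>S\<close> of coordinates, it compares the codewords of \<open>D\<^sup>\<bottom>\<close> that vanish on \<open>S\<close> with the
  codewords of \<open>D\<close> that vanish off \<open>S\<close>. Writing each weight as
  \<open>b i + (a i - b i) [u i = 0]\<close> and expanding the product over the subsets \<open>S\<close> expresses both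
  sides of the identity through these counts (\<open>sum_prod_zero_pattern\<close>).

  It remains to relate \<open>D\<close> to \<open>C\<close>. A basis of \<open>C\<close> stays independent over the larger
  field, so \<open>|D| = Q ^ k\<close> (\<open>card_ext_code\<close>), whose inverse is
  the scalar factor of the theorem. The extension of
  \<open>C\<^sup>\<bottom>\<close> is orthogonal to \<open>D\<close> and has the cardinality of \<open>D\<^sup>\<bottom>\<close>, so the two
  codes are equal (\<open>ext_code_dual\<close>).
\<close>

section \<open>Counting in finite vector spaces\<close>

abbreviation dot :: "'b::field ^ 'n \<Rightarrow> 'b ^ 'n \<Rightarrow> 'b" where
  "dot u v \<equiv> \<Sum>i\<in>UNIV. u $ i * v $ i"

lemma dot_commute: "dot u v = dot v u"
  by (simp add: mult.commute)

lemma dot_add_right: "dot u (v + w) = dot u v + dot u w"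
  by (simp add: algebra_simps sum.distrib)

lemma dot_scale_right: "dot u (c *s v) = c * dot u v"
  by (simp add: sum_distrib_left mult_ac)

lemma subspace_orthogonal: "vec.subspace {v. dot u v = 0}"
  unfolding vec.subspace_def
  by (auto simp: dot_add_right dot_scale_right simp del: vector_smult_component vector_add_component)

lemma subspace_dual_code: "vec.subspace (dual_code C)"
proof -
  have "dual_code C = (\<Inter>v\<in>C. {u. dot v u = 0})"
    by (auto simp: dual_code_def mult.commute)
  then show ?thesis
    by (simp add: vec.subspace_Inter subspace_orthogonal)
qed

text \<open>
  The translates of \<open>U\<close> by the multiples of \<open>a\<close> are disjoint: two multiples whose difference is in
  \<open>U\<close> are equal, as otherwise \<open>a\<close> would be in \<open>U\<close>. The set of the statement is the form in
  which the span of a set with one more generator appears.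
\<close>

lemma card_translates_along_line:
  fixes U :: "('b::{field,finite} ^ 'n::finite) set"
  assumes "vec.subspace U" and "a \<notin> U"
  shows "card {x. \<exists>k. x - k *s a \<in> U} = CARD('b) * card U"
proof -
  have inj: "inj_on (\<lambda>(k, y). y + k *s a) (UNIV \<times> U)"
  proof (clarsimp simp: inj_on_def)
    fix k y l z
    assume y: "y \<in> U" and z: "z \<in> U" and eq: "y + k *s a = z + l *s a"
    have *: "(k - l) *s a = z - y"
      using eq by (simp add: algebra_simps vec.scale_left_diff_distrib)
    have "k = l"
    proof (rule ccontr)
      assume "k \<noteq> l"
      have "inverse (k - l) *s ((k - l) *s a) \<in> U"
        unfolding * using assms(1) y z by (intro vec.subspace_scale vec.subspace_diff)
      then show False
        using \<open>k \<noteq> l\<close> assms(2) by simp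
    qed
    then show "k = l \<and> y = z" using eq by simp
  qed
  have "x \<in> (\<lambda>(k, y). y + k *s a) ` (UNIV \<times> U)" if "x - k *s a \<in> U" for x k
    using that by (intro image_eqI[of _ _ "(k, x - k *s a)"]) auto
  moreover have "\<exists>l. (y + k *s a) - l *s a \<in> U" if "y \<in> U" for y k
    using that by (intro exI[of _ k]) simp
  ultimately have "{x. \<exists>k. x - k *s a \<in> U} = (\<lambda>(k, y). y + k *s a) ` (UNIV \<times> U)"
    by auto
  then show ?thesis
    by (simp add: card_image[OF inj] card_cartesian_product)
qed

lemma card_span_independent:
  fixes B :: "('b::{field,finite} ^ 'n::finite) set"
  assumes "vec.independent B"
  shows "card (vec.span B) = CARD('b) ^ card B"
proof -
  have "finite B" by simp
  then show ?thesis using assms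
  proof (induction B)
    case empty
    then show ?case by simp
  next
    case (insert a B)
    then have "a \<notin> vec.span B" "vec.independent B"
      by (simp_all add: vec.independent_insert)
    then show ?case
      using insert.IH insert.hyps
        card_translates_along_line[OF vec.subspace_span[of B], of a]
      by (simp add: vec.span_insert)
  qed
qed

text \<open>
  A linear functional that does not vanish on \<open>U\<close> takes each value equally often: if it is
  nonzero at \<open>a\<close>, the translates of its kernel along the line through \<open>a\<close> partition \<open>U\<close>.
\<close>

lemma card_zeros_of_functional:
  fixes U :: "('b::{field,finite} ^ 'n::finite) set"
  assumes U: "vec.subspace U" and v: "v \<notin> dual_code U"
  shows "CARD('b) * card {u \<in> U. dot u v = 0} = card U"
proof -
  obtain a where a: "a \<in> U" "dot v a \<noteq> 0"
    using v by (auto simp: dual_code_def)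
  let ?K = "U \<inter> {u. dot v u = 0}"
  have K: "vec.subspace ?K"
    by (intro vec.subspace_inter U subspace_orthogonal)
  have aK: "a \<notin> ?K" using a by simp
  have "{x. \<exists>k. x - k *s a \<in> ?K} = U"
  proof (intro equalityI subsetI)
    fix x assume "x \<in> {x. \<exists>k. x - k *s a \<in> ?K}"
    then obtain k where "x - k *s a \<in> U" by auto
    then have "x - k *s a + k *s a \<in> U"
      using U a(1) by (intro vec.subspace_add vec.subspace_scale)
    then show "x \<in> U" by simp
  next
    fix x assume x: "x \<in> U"
    define k where "k = dot v x / dot v a"
    have "x - k *s a \<in> U"
      using U a(1) x by (intro vec.subspace_diff vec.subspace_scale)
    moreover have "dot v (x - k *s a) = 0"
    proof -
      have "dot v x = dot v (x - k *s a) + dot v (k *s a)"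
        unfolding dot_add_right[symmetric] by simp
      also have "dot v (k *s a) = dot v x"
        unfolding dot_scale_right k_def using a by simp
      finally show ?thesis by (simp only: add_cancel_right_left)
    qed
    ultimately show "x \<in> {x. \<exists>k. x - k *s a \<in> ?K}" by auto
  qed
  moreover have "?K = {u \<in> U. dot u v = 0}"
    by (auto simp: mult.commute)
  ultimately show ?thesis
    using card_translates_along_line[OF K aK] by simp
qed

text \<open>
  The double sum counts the orthogonal pairs of \<open>D \<times> V\<close>. A vector \<open>v\<close> is orthogonal to all of
  \<open>D\<close> or to exactly one in \<open>CARD('b)\<close> of its elements.
\<close>

lemma card_orthogonal_pairs:
  fixes D V :: "('b::{field,finite} ^ 'n::finite) set"
  assumes D: "vec.subspace D"
  shows "CARD('b) * (\<Sum>v\<in>V. \<Sum>u\<in>D. of_bool (dot u v = 0)) =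
    card V * card D + (CARD('b) - 1) * (card D * card (dual_code D \<inter> V))"
proof -
  have inner: "CARD('b) * (\<Sum>u\<in>D. of_bool (dot u v = 0)) =
      card D + (CARD('b) - 1) * card D * of_bool (v \<in> dual_code D)" for v
  proof -
    have "(\<Sum>u\<in>D. of_bool (dot u v = 0)) = card {u \<in> D. dot u v = 0}"
      by (simp add: Int_def)
    moreover have "{u \<in> D. dot u v = 0} = D" if "v \<in> dual_code D"
      using that by (auto simp: dual_code_def mult.commute)
    moreover have "CARD('b) * card D = card D + (CARD('b) - 1) * card D"
      by (cases "CARD('b)") simp_all
    ultimately show ?thesis
      using card_zeros_of_functional[OF D, of v] by (cases "v \<in> dual_code D") simp_all
  qed
  have "CARD('b) * (\<Sum>v\<in>V. \<Sum>u\<in>D. of_bool (dot u v = 0)) =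
      (\<Sum>v\<in>V. card D + (CARD('b) - 1) * card D * of_bool (v \<in> dual_code D))"
    by (simp only: sum_distrib_left[of _ _ V] inner)
  also have "\<dots> = card V * card D +
      (CARD('b) - 1) * card D * (\<Sum>v\<in>V. of_bool (v \<in> dual_code D))"
    by (simp only: sum.distrib sum_constant sum_distrib_left of_nat_id)
  also have "(\<Sum>v\<in>V. of_bool (v \<in> dual_code D)) = card (dual_code D \<inter> V)"
    by (simp add: Int_commute)
  finally show ?thesis by (simp add: mult.assoc)
qed

lemma two_le_CARD_field: "2 \<le> CARD('b::{field,finite})"
proof -
  have "card {0, 1 :: 'b} \<le> CARD('b)" by (rule card_mono) auto
  then show ?thesis by simp
qed

text \<open>
  The set of orthogonal pairs is symmetric in \<open>D\<close> and \<open>V\<close>, so the two evaluations of its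
  cardinality agree. Their terms \<open>|V| |D|\<close> cancel, and the factor \<open>CARD('b) - 1\<close> is not zero.
\<close>

lemma card_dual_Int:
  fixes D V :: "('b::{field,finite} ^ 'n::finite) set"
  assumes D: "vec.subspace D" and V: "vec.subspace V"
  shows "card D * card (dual_code D \<inter> V) = card V * card (D \<inter> dual_code V)"
proof -
  have "(\<Sum>v\<in>V. \<Sum>u\<in>D. of_bool (dot u v = 0)) =
      (\<Sum>u\<in>D. \<Sum>v\<in>V. of_bool (dot v u = 0) :: nat)"
    by (subst sum.swap) (simp only: dot_commute)
  then have "(CARD('b) - 1) * (card D * card (dual_code D \<inter> V)) =
      (CARD('b) - 1) * (card V * card (dual_code V \<inter> D))"
    using card_orthogonal_pairs[OF D, of V] card_orthogonal_pairs[OF V, of D]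
    by (simp add: mult.commute)
  then show ?thesis
    using two_le_CARD_field[where 'b = 'b] by (simp add: Int_commute)
qed

text \<open>
  This is the preceding relation for \<open>V = UNIV\<close>, whose dual is the zero space.
\<close>

lemma card_dual_code:
  fixes D :: "('b::{field,finite} ^ 'n::finite) set"
  assumes "vec.subspace D"
  shows "card D * card (dual_code D) = CARD('b) ^ CARD('n)"
proof -
  have "dual_code UNIV = ({0} :: ('b ^ 'n) set)"
  proof (intro equalityI subsetI)
    fix u :: "'b ^ 'n" assume u: "u \<in> dual_code UNIV"
    have "u $ i = 0" for i
    proof -
      have "dot u (axis i 1) = 0" using u by (simp add: dual_code_def)
      then show ?thesis by (simp add: axis_def if_distrib cong: if_cong)
    qed
    then show "u \<in> {0}" by (simp add: vec_eq_iff)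
  qed (simp add: dual_code_def)
  then show ?thesis
    using card_dual_Int[OF assms vec.subspace_UNIV] assms
    by (simp add: CARD_vec vec.subspace_0 card_insert_if Int_insert_right)
qed

section \<open>The MacWilliams identity in product form\<close>

lemma dual_code_supported_on:
  "dual_code {v. \<forall>i\<in>S. v $ i = 0} = {u :: 'b::field ^ 'n::finite. \<forall>i\<in>-S. u $ i = 0}"
proof (intro equalityI subsetI)
  fix u :: "'b ^ 'n" assume u: "u \<in> dual_code {v. \<forall>i\<in>S. v $ i = 0}"
  have "u $ i = 0" if "i \<notin> S" for i
  proof -
    have "axis i 1 \<in> {v :: 'b ^ 'n. \<forall>i\<in>S. v $ i = 0}"
      using that by (auto simp: axis_def)
    then have "dot u (axis i 1) = 0"
      using u unfolding dual_code_def by blast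
    then show ?thesis by (simp add: axis_def if_distrib cong: if_cong)
  qed
  then show "u \<in> {u. \<forall>i\<in>-S. u $ i = 0}" by simp
next
  fix u :: "'b ^ 'n" assume "u \<in> {u. \<forall>i\<in>-S. u $ i = 0}"
  then show "u \<in> dual_code {v. \<forall>i\<in>S. v $ i = 0}"
    by (auto simp: dual_code_def intro!: sum.neutral)
qed

lemma card_supported_on:
  "card {v :: 'b::{field,finite} ^ 'n::finite. \<forall>i\<in>S. v $ i = 0} = CARD('b) ^ card (- S)"
proof -
  have "bij_betw (\<lambda>v. restrict (vec_nth v) (- S))
      {v :: 'b ^ 'n. \<forall>i\<in>S. v $ i = 0} (PiE (- S) (\<lambda>_. UNIV))"
  proof (rule bij_betw_byWitness[where f' = "\<lambda>f. \<chi> i. if i \<in> S then 0 else f i"])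
    show "\<forall>f\<in>PiE (- S) (\<lambda>_. UNIV). restrict (vec_nth (\<chi> i. if i \<in> S then 0 else f i)) (- S) = f"
      by (auto simp: fun_eq_iff PiE_def extensional_def restrict_def)
  qed (auto simp: vec_eq_iff)
  from bij_betw_same_card[OF this] show ?thesis
    by (simp add: card_PiE)
qed

text \<open>
  Each factor is \<open>c i [u i = 0] + d i\<close>. Expanding the product chooses the set \<open>S\<close> of
  coordinates that contribute the first summand, and the term of \<open>S\<close> survives for the vectors that
  vanish on \<open>S\<close>.
\<close>

lemma sum_prod_zero_pattern:
  fixes c d :: "'n::finite \<Rightarrow> 'r::comm_ring_1" and A :: "('b::{zero,finite} ^ 'n) set"
  shows "(\<Sum>u\<in>A. \<Prod>i\<in>UNIV. if u $ i = 0 then c i + d i else d i) =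
    (\<Sum>S\<in>UNIV. of_nat (card {u \<in> A. \<forall>i\<in>S. u $ i = 0}) * ((\<Prod>i\<in>S. c i) * (\<Prod>i\<in>-S. d i)))"
proof -
  have "(\<Prod>i\<in>UNIV. if u $ i = 0 then c i + d i else d i) =
      (\<Sum>S\<in>UNIV. of_bool (\<forall>i\<in>S. u $ i = 0) * ((\<Prod>i\<in>S. c i) * (\<Prod>i\<in>-S. d i)))" for u :: "'b ^ 'n"
  proof -
    have "(\<Prod>i\<in>UNIV. if u $ i = 0 then c i + d i else d i) =
        (\<Prod>i\<in>UNIV. (of_bool (u $ i = 0) * c i) + d i)"
      by (rule prod.cong) auto
    also have "\<dots> = (\<Sum>S\<in>UNIV. (\<Prod>i\<in>S. of_bool (u $ i = 0) * c i) * (\<Prod>i\<in>-S. d i))"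
      by (subst prod_add) (auto simp: Compl_eq_Diff_UNIV)
    also have "\<dots> = (\<Sum>S\<in>UNIV. of_bool (\<forall>i\<in>S. u $ i = 0) * ((\<Prod>i\<in>S. c i) * (\<Prod>i\<in>-S. d i)))"
    proof (rule sum.cong)
      fix S :: "'n set"
      have "(\<Prod>i\<in>S. of_bool (u $ i = 0) :: 'r) = of_bool (\<forall>i\<in>S. u $ i = 0)"
        by (cases "\<forall>i\<in>S. u $ i = 0") (auto intro!: prod_zero)
      then show "(\<Prod>i\<in>S. of_bool (u $ i = 0) * c i) * (\<Prod>i\<in>-S. d i) =
          of_bool (\<forall>i\<in>S. u $ i = 0) * ((\<Prod>i\<in>S. c i) * (\<Prod>i\<in>-S. d i))"
        by (simp add: prod.distrib mult.assoc)
    qed simp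
    finally show ?thesis .
  qed
  then have "(\<Sum>u\<in>A. \<Prod>i\<in>UNIV. if u $ i = 0 then c i + d i else d i) =
      (\<Sum>S\<in>UNIV. \<Sum>u\<in>A. of_bool (\<forall>i\<in>S. u $ i = 0) * ((\<Prod>i\<in>S. c i) * (\<Prod>i\<in>-S. d i)))"
    by (simp only:) (rule sum.swap)
  also have "\<dots> = (\<Sum>S\<in>UNIV. of_nat (card {u \<in> A. \<forall>i\<in>S. u $ i = 0}) *
      ((\<Prod>i\<in>S. c i) * (\<Prod>i\<in>-S. d i)))"
    by (simp only: sum_distrib_right[symmetric]) (simp add: Int_def)
  finally show ?thesis .
qed

text \<open>
  Both sides are expanded over sets \<open>S\<close> of coordinates: the left one with \<open>c = a - b\<close>, \<open>d = b\<close>,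
  the right one with \<open>c = Q b\<close>, \<open>d = a - b\<close>. The duality of the counts turns the term of
  \<open>S\<close> on the left into the term of the complement of \<open>S\<close> on the right; its factor
  \<open>Q ^ card (- S)\<close> is distributed over the weights \<open>b i\<close> for \<open>i\<close> outside \<open>S\<close>.
\<close>

lemma macwilliams_product:
  fixes a b :: "'n::finite \<Rightarrow> 'r::comm_ring_1" and D :: "('b::{field,finite} ^ 'n) set"
  assumes D: "vec.subspace D"
  shows "of_nat (card D) * (\<Sum>v\<in>dual_code D. \<Prod>i\<in>UNIV. if v $ i = 0 then a i else b i) =
    (\<Sum>u\<in>D. \<Prod>i\<in>UNIV. if u $ i = 0 then a i + (of_nat CARD('b) - 1) * b i else a i - b i)"
proof -
  let ?Q = "of_nat CARD('b) :: 'r"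
  let ?z = "\<lambda>S (A :: ('b ^ 'n) set). of_nat (card {u \<in> A. \<forall>i\<in>S. u $ i = 0}) :: 'r"
  have count: "of_nat (card D) * ?z S (dual_code D) = ?Q ^ card (- S) * ?z (- S) D" for S
  proof -
    let ?V = "{v :: 'b ^ 'n. \<forall>i\<in>S. v $ i = 0}"
    have "vec.subspace ?V" by (auto simp: vec.subspace_def)
    from card_dual_Int[OF D this]
    have "card D * card {v \<in> dual_code D. \<forall>i\<in>S. v $ i = 0} =
        CARD('b) ^ card (- S) * card {u \<in> D. \<forall>i\<in>-S. u $ i = 0}"
      unfolding dual_code_supported_on card_supported_on by (simp only: Int_def mem_Collect_eq)
    then show ?thesis
      by (simp only: of_nat_mult[symmetric] of_nat_power[symmetric])
  qed
  have "(\<Sum>v\<in>dual_code D. \<Prod>i\<in>UNIV. if v $ i = 0 then a i else b i) =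
      (\<Sum>S\<in>UNIV. ?z S (dual_code D) * ((\<Prod>i\<in>S. a i - b i) * (\<Prod>i\<in>-S. b i)))"
    using sum_prod_zero_pattern[where A = "dual_code D" and c = "\<lambda>i. a i - b i" and d = b]
    by (simp cong: if_cong)
  then have "of_nat (card D) * (\<Sum>v\<in>dual_code D. \<Prod>i\<in>UNIV. if v $ i = 0 then a i else b i) =
      (\<Sum>S\<in>UNIV. (of_nat (card D) * ?z S (dual_code D)) * ((\<Prod>i\<in>S. a i - b i) * (\<Prod>i\<in>-S. b i)))"
    by (simp only: sum_distrib_left mult.assoc)
  also have "\<dots> = (\<Sum>S\<in>UNIV. ?z (- S) D * ((\<Prod>i\<in>-S. ?Q * b i) * (\<Prod>i\<in>S. a i - b i)))"
    unfolding count by (simp add: prod.distrib mult_ac)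
  also have "\<dots> = (\<Sum>S\<in>UNIV. ?z S D * ((\<Prod>i\<in>S. ?Q * b i) * (\<Prod>i\<in>-S. a i - b i)))"
    by (rule sum.reindex_bij_witness[of _ uminus uminus]) auto
  also have "\<dots> = (\<Sum>u\<in>D. \<Prod>i\<in>UNIV. if u $ i = 0 then ?Q * b i + (a i - b i) else a i - b i)"
    by (rule sum_prod_zero_pattern[symmetric])
  also have "\<dots> = (\<Sum>u\<in>D. \<Prod>i\<in>UNIV. if u $ i = 0 then a i + (?Q - 1) * b i else a i - b i)"
    by (intro sum.cong prod.cong) (auto simp: algebra_simps)
  finally show ?thesis .
qed

section \<open>Extension of scalars\<close>

context
  fixes \<iota> :: "'a::field \<Rightarrow> 'b::field"
  assumes emb: "field_embedding \<iota>"
begin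

lemma embedding_add: "\<iota> (x + y) = \<iota> x + \<iota> y"
  and embedding_mult: "\<iota> (x * y) = \<iota> x * \<iota> y"
  and embedding_1: "\<iota> 1 = 1"
  using emb by (auto simp: field_embedding_def)

lemma embedding_0: "\<iota> 0 = 0"
  using embedding_add[of 0 0] unfolding add_0_left add_cancel_right_right .

lemma embedding_sum: "\<iota> (sum f A) = (\<Sum>x\<in>A. \<iota> (f x))"
  by (induction A rule: infinite_finite_induct) (auto simp: embedding_0 embedding_add)

lemma embedding_inj: "inj \<iota>"
proof (rule injI, rule ccontr)
  fix x y assume eq: "\<iota> x = \<iota> y" and "x \<noteq> y"
  have "\<iota> (x - y) = 0"
    using embedding_add[of "x - y" y] eq by simp
  then have "\<iota> ((x - y) * inverse (x - y)) = 0"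
    by (simp add: embedding_mult)
  then show False
    using \<open>x \<noteq> y\<close> by (simp add: embedding_1)
qed

abbreviation embed_vec :: "'a ^ 'n \<Rightarrow> 'b ^ 'n" where
  "embed_vec u \<equiv> \<chi> i. \<iota> (u $ i)"

lemma embed_vec_span:
  fixes B :: "('a ^ 'n::finite) set"
  assumes "u \<in> vec.span B"
  shows "embed_vec u \<in> vec.span (embed_vec ` B)"
  using assms
proof (induction rule: vec.span_induct_alt)
  case base
  have "embed_vec (0 :: 'a ^ 'n) = 0" by (simp add: vec_eq_iff embedding_0)
  then show ?case by (simp add: vec.span_zero)
next
  case (step c x y)
  have "embed_vec (c *s x + y) = \<iota> c *s embed_vec x + embed_vec y"
    by (simp add: vec_eq_iff embedding_add embedding_mult)
  then show ?case
    using vec.span_add[OF vec.span_scale[OF vec.span_base[OF imageI[OF step(1)]]] step(2)]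
    by (simp only:)
qed

lemma ext_code_span: "ext_code \<iota> (vec.span B) = vec.span (embed_vec ` B)"
  for B :: "('a ^ 'n::finite) set"
  unfolding ext_code_def
proof (rule vec.span_eq[THEN iffD2], intro conjI subsetI)
  show "x \<in> vec.span (embed_vec ` B)" if "x \<in> embed_vec ` vec.span B" for x
    using that embed_vec_span by auto
  show "x \<in> vec.span (embed_vec ` vec.span B)" if "x \<in> embed_vec ` B" for x
    using that by (auto intro!: vec.span_base)
qed

lemma ext_code_UNIV: "ext_code \<iota> UNIV = (UNIV :: ('b ^ 'n::finite) set)"
proof -
  have "cart_basis \<subseteq> range (embed_vec :: 'a ^ 'n \<Rightarrow> _)"
  proof
    fix v :: "'b ^ 'n" assume "v \<in> cart_basis"
    then obtain i where "v = axis i 1" by (auto simp: cart_basis_def)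
    then have "v = embed_vec (axis i 1)"
      by (simp add: vec_eq_iff axis_def embedding_0 embedding_1)
    then show "v \<in> range embed_vec" by blast
  qed
  from vec.span_mono[OF this] show ?thesis
    by (simp add: ext_code_def top.extremum_unique)
qed

text \<open>
  Extend \<open>B\<close> to a basis of the whole space. Its image spans the whole space over the larger
  field, because it spans the unit vectors, and a spanning set with at most as many elements as the
  dimension is independent.
\<close>

lemma independent_embed_vec:
  fixes B :: "('a ^ 'n::finite) set"
  assumes "vec.independent B"
  shows "vec.independent (embed_vec ` B)"
proof -
  let ?E = "vec.extend_basis B"
  have "vec.independent ?E" and span: "vec.span ?E = UNIV" and sub: "B \<subseteq> ?E"
    using assms by (simp_all add: vec.independent_extend_basis vec.extend_basis_superset)
  then have fin: "finite ?E" and card: "card ?E = CARD('n)"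
    using vec.dim_eq_card[of ?E UNIV] by (auto intro: vec.finiteI_independent simp: card_cart_basis)
  have "vec.independent (embed_vec ` ?E)"
  proof (rule vec.card_le_dim_spanning[where V = UNIV])
    show "UNIV \<subseteq> vec.span (embed_vec ` ?E)"
      using ext_code_span[of ?E] ext_code_UNIV[where 'n = 'n] by (simp add: span)
    show "card (embed_vec ` ?E) \<le> vec.dim (UNIV :: ('b ^ 'n) set)"
      using card_image_le[OF fin] card by (simp add: card_cart_basis)
  qed (use fin in auto)
  then show ?thesis
    by (rule vec.independent_mono) (use sub in auto)
qed

end

lemma card_ext_code:
  fixes C :: "('a::{field,finite} ^ 'n::finite) set" and \<iota> :: "'a \<Rightarrow> 'b::{field,finite}"
  assumes emb: "field_embedding \<iota>" and C: "vec.subspace C"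
  shows "card (ext_code \<iota> C) = CARD('b) ^ vec.dim C"
proof -
  obtain B where B: "vec.independent B" "vec.span B = C" "card B = vec.dim C"
    using vec.basis_subspace_exists[OF C] by blast
  have "inj_on (\<lambda>u :: 'a ^ 'n. \<chi> i. \<iota> (u $ i)) B"
    using embedding_inj[OF emb] by (auto simp: inj_on_def vec_eq_iff)
  then show ?thesis
    using card_span_independent[OF independent_embed_vec[OF emb B(1)]]
      ext_code_span[OF emb, of B] B
    by (simp add: card_image)
qed

text \<open>
  Orthogonality of the generators extends to their spans, which gives one inclusion. Both codes have
  cardinality \<open>Q ^ (n - k)\<close>, since the dimensions of \<open>C\<close> and its dual add up to \<open>n\<close>.
\<close>

lemma ext_code_dual:
  fixes C :: "('a::{field,finite} ^ 'n::finite) set" and \<iota> :: "'a \<Rightarrow> 'b::{field,finite}"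
  assumes emb: "field_embedding \<iota>" and C: "vec.subspace C"
  shows "ext_code \<iota> (dual_code C) = dual_code (ext_code \<iota> C)"
proof (rule card_subset_eq)
  let ?e = "\<lambda>u :: 'a ^ 'n. \<chi> i. \<iota> (u $ i)"
  have base: "dot (?e u) (?e v) = 0" if "u \<in> dual_code C" "v \<in> C" for u v
  proof -
    have "dot (?e u) (?e v) = \<iota> (dot u v)"
      by (simp add: embedding_sum[OF emb] embedding_mult[OF emb])
    then show ?thesis
      using that by (simp add: dual_code_def embedding_0[OF emb])
  qed
  have orth: "ext_code \<iota> C \<subseteq> {y. dot (?e u) y = 0}" if "u \<in> dual_code C" for u
    unfolding ext_code_def using that base
    by (intro vec.span_minimal subspace_orthogonal) auto
  have "?e ` dual_code C \<subseteq> dual_code (ext_code \<iota> C)"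
    unfolding dual_code_def[of "ext_code \<iota> C"] using orth by blast
  then show "ext_code \<iota> (dual_code C) \<subseteq> dual_code (ext_code \<iota> C)"
    unfolding ext_code_def[of \<iota> "dual_code C"]
    by (intro vec.span_minimal subspace_dual_code)
  have sub: "vec.subspace (ext_code \<iota> C)"
    by (simp add: ext_code_def)
  \<comment> \<open>The dimension formula is read off from the cardinalities over the small field.\<close>
  have dim: "vec.dim C + vec.dim (dual_code C) = CARD('n)"
  proof -
    have "card U = CARD('a) ^ vec.dim U" if "vec.subspace U" for U :: "('a ^ 'n) set"
      using vec.basis_subspace_exists[OF that] card_span_independent by metis
    then have "CARD('a) ^ (vec.dim C + vec.dim (dual_code C)) = CARD('a) ^ CARD('n)"
      using card_dual_code[OF C] C subspace_dual_code[of C] by (simp add: power_add)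
    then show ?thesis
      using two_le_CARD_field[where 'b = 'a] by (subst (asm) power_inject_exp) auto
  qed
  have "card (ext_code \<iota> C) * card (ext_code \<iota> (dual_code C)) =
      card (ext_code \<iota> C) * card (dual_code (ext_code \<iota> C))"
    using card_dual_code[OF sub]
    by (simp add: card_ext_code[OF emb] C subspace_dual_code power_add[symmetric] dim)
  then show "card (ext_code \<iota> (dual_code C)) = card (dual_code (ext_code \<iota> C))"
    using C by (simp add: card_ext_code[OF emb])
qed simp

section \<open>Jacobi polynomials as sums over codewords\<close>

lemma card_complement: "card (- T) = CARD('n) - card T" for T :: "'n::finite set"
  by (simp add: Compl_eq_Diff_UNIV card_Diff_subset)

lemma prod_split_weights:
  fixes u :: "'b::zero ^ 'n::finite" and w z x y :: "'r::comm_monoid_mult"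
  shows "(\<Prod>i\<in>UNIV. if u $ i = 0 then (if i \<in> T then w else x) else (if i \<in> T then z else y)) =
    w ^ (card T - wt_on T u) * z ^ wt_on T u *
    x ^ (CARD('n) - card T - wt_on (- T) u) * y ^ wt_on (- T) u"
proof -
  have part: "(\<Prod>i\<in>S. if u $ i = 0 then p else r) = p ^ (card S - wt_on S u) * r ^ wt_on S u"
    for S :: "'n set" and p r :: 'r
  proof -
    have "card (S \<inter> {i. u $ i = 0}) = card S - wt_on S u"
    proof -
      have "S \<inter> {i. u $ i = 0} = S - {i \<in> S. u $ i \<noteq> 0}" by auto
      then show ?thesis by (simp add: wt_on_def card_Diff_subset)
    qed
    moreover have "S \<inter> - {i. u $ i = 0} = {i \<in> S. u $ i \<noteq> 0}" by auto
    ultimately show ?thesis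
      by (subst prod.If_cases) (simp_all add: wt_on_def)
  qed
  let ?f = "\<lambda>i. if u $ i = 0 then (if i \<in> T then w else x) else (if i \<in> T then z else y)"
  have "prod ?f UNIV = prod ?f (T \<union> - T)" by simp
  also have "\<dots> = prod ?f T * prod ?f (- T)" by (rule prod.union_disjoint) auto
  also have "prod ?f T = (\<Prod>i\<in>T. if u $ i = 0 then w else z)"
    by (rule prod.cong) auto
  also have "prod ?f (- T) = (\<Prod>i\<in>-T. if u $ i = 0 then x else y)"
    by (rule prod.cong) auto
  finally show ?thesis by (simp add: part card_complement mult.assoc)
qed

lemma sum_by_level_sets:
  fixes h :: "'i \<Rightarrow> 'j \<Rightarrow> 'r::comm_semiring_1"
  assumes "finite A" "finite I" "finite J"
    and "\<And>u. u \<in> A \<Longrightarrow> f u \<in> I" "\<And>u. u \<in> A \<Longrightarrow> g u \<in> J"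
  shows "(\<Sum>i\<in>I. \<Sum>j\<in>J. of_nat (card {u \<in> A. f u = i \<and> g u = j}) * h i j) = (\<Sum>u\<in>A. h (f u) (g u))"
proof -
  have "(\<Sum>i\<in>I. \<Sum>j\<in>J. of_nat (card {u \<in> A. f u = i \<and> g u = j}) * h i j) =
      (\<Sum>(i, j)\<in>I \<times> J. \<Sum>u\<in>{u \<in> A. (f u, g u) = (i, j)}. h (f u) (g u))"
    unfolding sum.cartesian_product by (auto intro!: sum.cong)
  also have "\<dots> = (\<Sum>u\<in>A. h (f u) (g u))"
    using sum.group[of A "I \<times> J" "\<lambda>u. (f u, g u)" "\<lambda>u. h (f u) (g u)"] assms
    by (auto simp: case_prod_beta prod_eq_iff image_subset_iff)
  finally show ?thesis .
qed

lemma jacobi_sum_codewords: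
  fixes C :: "('a::field ^ 'n::finite) set" and \<iota> :: "'a \<Rightarrow> 'b::{field,finite}"
  shows "jacobi \<iota> C T = (\<Sum>u\<in>ext_code \<iota> C.
    Var W ^ (card T - wt_on T u) * Var Z ^ wt_on T u *
    Var X ^ (CARD('n) - card T - wt_on (- T) u) * Var Y ^ wt_on (- T) u)"
proof -
  have le: "wt_on S u \<le> card S" for S and u :: "'b ^ 'n"
    unfolding wt_on_def by (rule card_mono) auto
  show ?thesis
    unfolding jacobi_def split_count_def mult.assoc
    by (rule sum_by_level_sets) (use le le[of "- T"] in \<open>auto simp: card_complement\<close>)
qed

lemma Const_of_nat: "Const (of_nat c) = of_nat c"
  by (simp add: Const_def)

lemma Const_1: "Const 1 = 1"
  by (simp add: Const_def)

lemma Const_mult: "Const (c * d) = Const c * Const d"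
  by (simp add: Const_def mult_single)

lemma Const_diff: "Const (c - d) = Const c - Const d"
  by (simp add: Const_def single_diff)

lemma Const_add: "Const (c + d) = Const c + Const d"
  by (simp add: Const_def single_add)

text \<open>
  Substitution sums over the support of a polynomial, and supports vary under addition.
  Summation over a common finite superset of the supports makes additivity evident.
\<close>

lemma psubst_superset:
  assumes "finite K" "Poly_Mapping.keys p \<subseteq> K"
  shows "psubst p a b c d =
    (\<Sum>e\<in>K. Const (Poly_Mapping.lookup p e) *
      a ^ Poly_Mapping.lookup e W * b ^ Poly_Mapping.lookup e Z *
      c ^ Poly_Mapping.lookup e X * d ^ Poly_Mapping.lookup e Y)"
  unfolding psubst_def using assms
  by (intro sum.mono_neutral_left) (auto simp: in_keys_iff Const_def)

lemma psubst_add: "psubst (p + r) a b c d = psubst p a b c d + psubst r a b c d"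
proof -
  let ?K = "Poly_Mapping.keys p \<union> Poly_Mapping.keys r"
  have "Poly_Mapping.keys (p + r) \<subseteq> ?K" by (rule keys_add)
  then show ?thesis
    by (subst (1 2 3) psubst_superset[where K = ?K])
      (auto simp: lookup_add Const_add algebra_simps sum.distrib)
qed

lemma psubst_sum: "psubst (sum f A) a b c d = (\<Sum>u\<in>A. psubst (f u) a b c d)"
  by (induction A rule: infinite_finite_induct) (auto simp: psubst_add psubst_def[of 0])

lemma Var_power: "Var v ^ j = Poly_Mapping.single (Poly_Mapping.single v j) 1"
  by (induction j) (auto simp: Var_def mult_single single_add[symmetric])

lemma psubst_monomial:
  "psubst (Var W ^ i * Var Z ^ j * Var X ^ k * Var Y ^ l) a b c d = a ^ i * b ^ j * c ^ k * d ^ l"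
  by (simp add: Var_power mult_single psubst_def Const_1 lookup_add lookup_single)

theorem theorem3p3:
  fixes C :: "('a::{field,finite} ^ 'n::finite) set"
    and \<iota> :: "'a \<Rightarrow> 'b::{field,finite}"
    and T :: "'n set"
    and q k m :: nat
  assumes "CARD('a) = q"
    and "vec.subspace C" and "vec.dim C = k"
    and "m > 0"
    and "CARD('b) = q ^ m" and "field_embedding \<iota>"
  shows "jacobi \<iota> (dual_code C) T =
    Const (1 / of_nat q ^ (k * m)) *
    psubst (jacobi \<iota> C T)
      (Var W + Const (of_nat q ^ m - 1) * Var Z) (Var W - Var Z)
      (Var X + Const (of_nat q ^ m - 1) * Var Y) (Var X - Var Y)"
proof -
  let ?D = "ext_code \<iota> C"
  let ?a = "\<lambda>i. if i \<in> T then Var W else Var X" and ?b = "\<lambda>i. if i \<in> T then Var Z else Var Y"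
  let ?c = "Const (of_nat q ^ m - 1)"
  have D: "vec.subspace ?D" by (simp add: ext_code_def)
  have cardD: "card ?D = q ^ (k * m)"
    using card_ext_code[OF assms(6,2)] assms(3,5) by (simp add: power_mult[symmetric] mult.commute)
  have c: "?c = of_nat CARD('b) - 1"
    using assms(5) Const_of_nat[of "q ^ m"] by (simp add: Const_diff Const_1)
  have "q \<noteq> 0" using assms(1) by auto
  then have "Const (1 / of_nat q ^ (k * m)) * of_nat (card ?D) = 1"
    unfolding Const_of_nat[symmetric] Const_mult[symmetric] by (simp add: cardD Const_1)
  moreover have "jacobi \<iota> (dual_code C) T =
      (\<Sum>v\<in>dual_code ?D. \<Prod>i\<in>UNIV. if v $ i = 0 then ?a i else ?b i)"
    unfolding prod_split_weights jacobi_sum_codewords ext_code_dual[OF assms(6,2)] ..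
  ultimately have "jacobi \<iota> (dual_code C) T = Const (1 / of_nat q ^ (k * m)) *
      (of_nat (card ?D) * (\<Sum>v\<in>dual_code ?D. \<Prod>i\<in>UNIV. if v $ i = 0 then ?a i else ?b i))"
    by (simp only: mult.assoc[symmetric] mult_1_left)
  also have "of_nat (card ?D) * (\<Sum>v\<in>dual_code ?D. \<Prod>i\<in>UNIV. if v $ i = 0 then ?a i else ?b i) =
      (\<Sum>u\<in>?D. \<Prod>i\<in>UNIV. if u $ i = 0 then ?a i + ?c * ?b i else ?a i - ?b i)"
    unfolding c by (rule macwilliams_product[OF D])
  also have "\<dots> = (\<Sum>u\<in>?D. \<Prod>i\<in>UNIV.
      if u $ i = 0 then (if i \<in> T then Var W + ?c * Var Z else Var X + ?c * Var Y)
      else (if i \<in> T then Var W - Var Z else Var X - Var Y))"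
    by (intro sum.cong prod.cong) auto
  also have "\<dots> = psubst (jacobi \<iota> C T) (Var W + ?c * Var Z) (Var W - Var Z)
      (Var X + ?c * Var Y) (Var X - Var Y)"
    unfolding prod_split_weights jacobi_sum_codewords psubst_sum psubst_monomial ..
  finally show ?thesis .
qed

end
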